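(* Let $(X,\kappa)$ and $(Y,\lambda)$ be digital images, and let $x_1\in X$, $y_1\in Y$ be such that $(X,x_1)$ and $(Y,y_1)$ are pointed homotopically similar, $(X,x_1)\simeq^s_{\kappa,\lambda}(Y,y_1)$. Then there is a group isomorphism $F:\Pi_1^{\kappa}(X,x_1)\to\Pi_1^{\lambda}(Y,y_1)$.
   Context: A digital image $(X,\kappa)$ is a set $X\subset\mathbb Z^n$ (for some $n\ge 1$) with an adjacency relation $\kappa$ (a symmetric, irreflexive relation). A subset is $\kappa$-connected if any two distinct points of it are joined by a finite sequence of points of the subset whose consecutive members are $\kappa$-adjacent. A function $f:(X,\kappa)\to(Y,\lambda)$ is $(\kappa,\lambda)$-continuous if it maps $\kappa$-connected sets to $\lambda$-connected sets; equivalently, $\kappa$-adjacent points are mapped to equal or $\lambda$-adjacent points. $\mathbb N=\{1,2,\dots\}$, $\mathbb N^*=\{0\}\cup\mathbb N$, $[a,b]_{\mathbb Z}=\{z\in\mathbb Z: a\le z\le b\}$; subsets of $\mathbb Z$ carry the adjacency in which consecutive integers are adjacent. Homotopy: continuous $f,g:X\to Y$ are homotopic in $Y$, $f\simeq_{\kappa,\lambda} g$, if there are a positive integer $m$ and a function $F:X\times[0,m]_{\mathbb Z}\to Y$ with $F(x,0)=f(x)$, $F(x,m)=g(x)$ for all $x$, such that $t\mapsto F(x,t)$ is continuous for each $x\in X$ and $x\mapsto F(x,t)$ is $(\kappa,\lambda)$-continuous for each $t$. $F$ holds $x$ fixed if $F(x,t)=F(x,0)$ for all $t$. Homotopic similarity: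 $X\simeq^s_{\kappa,\lambda}Y$ if there are subsets $X_j\subset X$, $Y_j\subset Y$ ($j\ge1$) with $X_j\subset X_{j+1}$, $Y_j\subset Y_{j+1}$, $X=\bigcup_j X_j$, $Y=\bigcup_j Y_j$, and continuous $f_j:X_j\to Y_j$, $g_j:Y_j\to X_j$ such that $g_j\circ f_j\simeq_{\kappa,\kappa}1_{X_j}$ (in $X_j$), $f_j\circ g_j\simeq_{\lambda,\lambda}1_{Y_j}$ (in $Y_j$), and for $v\le w$, $f_w|_{X_v}\simeq_{\kappa,\lambda}f_v$ in $Y_v$ and $g_w|_{Y_v}\simeq_{\lambda,\kappa}g_v$ in $X_v$ (in particular $f_w(X_v)\subset Y_v$ and $g_w(Y_v)\subset X_v$). Pointed homotopic similarity $(X,x_1)\simeq^s(Y,y_1)$ means in addition $x_1\in X_1$, $y_1\in Y_1$, $f_j(x_1)=y_1$, $g_j(y_1)=x_1$ for all $j$, and all these homotopies hold the base point ($x_1$ or $y_1$, whichever lies in the domain) fixed. Fundamental group: an EC path in $X$ is a continuous $f:\mathbb N^*\to X$ that is eventually constant, with eventual value $f(\infty)$; it is an EC loop based at $f(0)$ if $f(0)=f(\infty)$. An EC homotopy between EC paths $f,g$ is a homotopy $H:[0,k]_{\mathbb Z}\times\mathbb N^*\to X$ ($[0,k]_{\mathbb Z}$ is the homotopy parameter) from $f$ to $g$ such that every $H_s(t)=H(s,t)$ is an EC path; it holds the endpoints fixed if $H_s(0)=f(0)=g(0)$ for all $s$ and there is $c\in\mathbb N$ with $H_s(n)=f(n)=g(n)$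 for all $n\ge c$ and all $s$. For an EC loop $f$, $N_f=\min\{m\in\mathbb N^*: f(n)=f(m)\text{ for all }n\ge m\}$. For $x_0$-based EC loops, $(f_0*f_1)(n)=f_0(n)$ if $0\le n\le N_{f_0}$ and $f_1(n-N_{f_0})$ if $n\ge N_{f_0}$. $\Pi_1^\kappa(X,x_0)$ is the set of classes $[f]$ of $x_0$-based EC loops under EC homotopy holding the endpoints fixed, a group under $[f]\cdot[g]=[f*g]$. *)

theory Defs
  imports "HOL-Analysis.Finite_Cartesian_Product" "HOL-Algebra.Group"
begin

text \<open>
  A digital image is a set of points of \<open>\<int>\<^sup>n\<close> with an adjacency relation. Only the values of
  the relation on the points of the image matter, and a subset of an image carries the restricted
  relation, so a single relation serves for an image and for all its subsets.
\<close>

definition digital_image :: "(int ^ 'n) set \<Rightarrow> (int ^ 'n \<Rightarrow> int ^ 'n \<Rightarrow> bool) \<Rightarrow> bool" where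
  "digital_image X \<kappa> \<longleftrightarrow> symp_on X \<kappa> \<and> irreflp_on X \<kappa>"

text \<open>
  The set \<open>\<nat>\<^sup>*\<close> is rendered as \<open>UNIV :: nat set\<close> and \<open>[0,m]\<^sub>\<int>\<close> as \<open>{0..m} :: nat set\<close>,
  both with consecutive numbers adjacent. The notions of connectedness, continuity and homotopy
  below are therefore stated for points of an arbitrary type.
\<close>

definition nat_adj :: "nat \<Rightarrow> nat \<Rightarrow> bool" where
  "nat_adj a b \<longleftrightarrow> b = Suc a \<or> a = Suc b"

definition digi_connected :: "('a \<Rightarrow> 'a \<Rightarrow> bool) \<Rightarrow> 'a set \<Rightarrow> bool" where
  "digi_connected \<kappa> A \<longleftrightarrow>
     (\<forall>x\<in>A. \<forall>y\<in>A. x \<noteq> y \<longrightarrow>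
        (\<exists>p. p \<noteq> [] \<and> hd p = x \<and> last p = y \<and> set p \<subseteq> A \<and> successively \<kappa> p))"

definition digi_continuous ::
    "'a set \<Rightarrow> ('a \<Rightarrow> 'a \<Rightarrow> bool) \<Rightarrow> 'b set \<Rightarrow> ('b \<Rightarrow> 'b \<Rightarrow> bool) \<Rightarrow> ('a \<Rightarrow> 'b) \<Rightarrow> bool" where
  "digi_continuous X \<kappa> Y \<mu> f \<longleftrightarrow>
     f ` X \<subseteq> Y \<and> (\<forall>A. A \<subseteq> X \<and> digi_connected \<kappa> A \<longrightarrow> digi_connected \<mu> (f ` A))"

definition digi_homotopy ::
    "'a set \<Rightarrow> ('a \<Rightarrow> 'a \<Rightarrow> bool) \<Rightarrow> 'b set \<Rightarrow> ('b \<Rightarrow> 'b \<Rightarrow> bool) \<Rightarrow>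
     ('a \<Rightarrow> 'b) \<Rightarrow> ('a \<Rightarrow> 'b) \<Rightarrow> nat \<Rightarrow> ('a \<Rightarrow> nat \<Rightarrow> 'b) \<Rightarrow> bool" where
  "digi_homotopy X \<kappa> Y \<mu> f g m F \<longleftrightarrow>
     digi_continuous X \<kappa> Y \<mu> f \<and> digi_continuous X \<kappa> Y \<mu> g \<and> 0 < m \<and>
     (\<forall>x\<in>X. F x 0 = f x \<and> F x m = g x) \<and>
     (\<forall>x\<in>X. digi_continuous {0..m} nat_adj Y \<mu> (\<lambda>t. F x t)) \<and>
     (\<forall>t\<in>{0..m}. digi_continuous X \<kappa> Y \<mu> (\<lambda>x. F x t))"

definition pointed_homotopic ::
    "'a set \<Rightarrow> ('a \<Rightarrow> 'a \<Rightarrow> bool) \<Rightarrow> 'b set \<Rightarrow> ('b \<Rightarrow> 'b \<Rightarrow> bool) \<Rightarrow> 'a \<Rightarrow>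
     ('a \<Rightarrow> 'b) \<Rightarrow> ('a \<Rightarrow> 'b) \<Rightarrow> bool" where
  "pointed_homotopic X \<kappa> Y \<mu> x0 f g \<longleftrightarrow>
     (\<exists>m F. digi_homotopy X \<kappa> Y \<mu> f g m F \<and> (\<forall>t\<in>{0..m}. F x0 t = F x0 0))"

text \<open>
  The maps \<open>f j\<close> and \<open>g j\<close> are total functions, of which only the restrictions to \<open>Xs j\<close> and
  \<open>Ys j\<close> are constrained. Indices start at \<open>1\<close>.
\<close>

definition pointed_homotopically_similar ::
    "'a set \<Rightarrow> ('a \<Rightarrow> 'a \<Rightarrow> bool) \<Rightarrow> 'a \<Rightarrow> 'b set \<Rightarrow> ('b \<Rightarrow> 'b \<Rightarrow> bool) \<Rightarrow> 'b \<Rightarrow> bool" where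
  "pointed_homotopically_similar X \<kappa> x1 Y \<mu> y1 \<longleftrightarrow>
     (\<exists>(Xs :: nat \<Rightarrow> 'a set) (Ys :: nat \<Rightarrow> 'b set)
       (f :: nat \<Rightarrow> 'a \<Rightarrow> 'b) (g :: nat \<Rightarrow> 'b \<Rightarrow> 'a).
        (\<forall>j\<ge>1. Xs j \<subseteq> Xs (Suc j) \<and> Ys j \<subseteq> Ys (Suc j)) \<and>
        X = (\<Union>j\<in>{1..}. Xs j) \<and> Y = (\<Union>j\<in>{1..}. Ys j) \<and>
        x1 \<in> Xs 1 \<and> y1 \<in> Ys 1 \<and>
        (\<forall>j\<ge>1. digi_continuous (Xs j) \<kappa> (Ys j) \<mu> (f j) \<and>
                digi_continuous (Ys j) \<mu> (Xs j) \<kappa> (g j) \<and>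
                f j x1 = y1 \<and> g j y1 = x1 \<and>
                pointed_homotopic (Xs j) \<kappa> (Xs j) \<kappa> x1 (g j \<circ> f j) id \<and>
                pointed_homotopic (Ys j) \<mu> (Ys j) \<mu> y1 (f j \<circ> g j) id) \<and>
        (\<forall>v\<ge>1. \<forall>w\<ge>v.
                pointed_homotopic (Xs v) \<kappa> (Ys v) \<mu> x1 (f w) (f v) \<and>
                pointed_homotopic (Ys v) \<mu> (Xs v) \<kappa> y1 (g w) (g v)))"

definition ec_path :: "'a set \<Rightarrow> ('a \<Rightarrow> 'a \<Rightarrow> bool) \<Rightarrow> (nat \<Rightarrow> 'a) \<Rightarrow> bool" where
  "ec_path X \<kappa> f \<longleftrightarrow>
     digi_continuous UNIV nat_adj X \<kappa> f \<and> (\<exists>m. \<forall>n\<ge>m. f n = f m)"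

definition ec_value :: "(nat \<Rightarrow> 'a) \<Rightarrow> 'a" where
  "ec_value f = (THE c. \<exists>m. \<forall>n\<ge>m. f n = c)"

definition ec_loops :: "'a set \<Rightarrow> ('a \<Rightarrow> 'a \<Rightarrow> bool) \<Rightarrow> 'a \<Rightarrow> (nat \<Rightarrow> 'a) set" where
  "ec_loops X \<kappa> x0 = {f. ec_path X \<kappa> f \<and> f 0 = x0 \<and> f 0 = ec_value f}"

definition ec_homotopy ::
    "'a set \<Rightarrow> ('a \<Rightarrow> 'a \<Rightarrow> bool) \<Rightarrow> (nat \<Rightarrow> 'a) \<Rightarrow> (nat \<Rightarrow> 'a) \<Rightarrow> nat \<Rightarrow>
     (nat \<Rightarrow> nat \<Rightarrow> 'a) \<Rightarrow> bool" where
  "ec_homotopy X \<kappa> f g k H \<longleftrightarrow>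
     digi_homotopy UNIV nat_adj X \<kappa> f g k (\<lambda>t s. H s t) \<and>
     (\<forall>s\<in>{0..k}. ec_path X \<kappa> (H s))"

definition holds_endpoints_fixed ::
    "(nat \<Rightarrow> 'a) \<Rightarrow> (nat \<Rightarrow> 'a) \<Rightarrow> nat \<Rightarrow> (nat \<Rightarrow> nat \<Rightarrow> 'a) \<Rightarrow> bool" where
  "holds_endpoints_fixed f g k H \<longleftrightarrow>
     (\<forall>s\<in>{0..k}. H s 0 = f 0 \<and> f 0 = g 0) \<and>
     (\<exists>c\<ge>1. \<forall>n\<ge>c. \<forall>s\<in>{0..k}. H s n = f n \<and> f n = g n)"

definition ec_homotopy_rel ::
    "'a set \<Rightarrow> ('a \<Rightarrow> 'a \<Rightarrow> bool) \<Rightarrow> 'a \<Rightarrow> ((nat \<Rightarrow> 'a) \<times> (nat \<Rightarrow> 'a)) set" where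
  "ec_homotopy_rel X \<kappa> x0 =
     {(f, g). f \<in> ec_loops X \<kappa> x0 \<and> g \<in> ec_loops X \<kappa> x0 \<and>
        (\<exists>k H. ec_homotopy X \<kappa> f g k H \<and> holds_endpoints_fixed f g k H)}"

definition ec_length :: "(nat \<Rightarrow> 'a) \<Rightarrow> nat" where
  "ec_length f = (LEAST m. \<forall>n\<ge>m. f n = f m)"

definition ec_concat :: "(nat \<Rightarrow> 'a) \<Rightarrow> (nat \<Rightarrow> 'a) \<Rightarrow> nat \<Rightarrow> 'a" where
  "ec_concat f g n = (if n \<le> ec_length f then f n else g (n - ec_length f))"

text \<open>
  The product of two classes is written as the union of the classes of all products of
  representatives, which is \<open>[f * g]\<close> once the product is known to respect the relation.
\<close>

definition fundamental_group ::
    "'a set \<Rightarrow> ('a \<Rightarrow> 'a \<Rightarrow> bool) \<Rightarrow> 'a \<Rightarrow> (nat \<Rightarrow> 'a) set monoid" where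
  "fundamental_group X \<kappa> x0 =
     \<lparr>carrier = ec_loops X \<kappa> x0 // ec_homotopy_rel X \<kappa> x0,
      mult = (\<lambda>A B. \<Union>f\<in>A. \<Union>g\<in>B. ec_homotopy_rel X \<kappa> x0 `` {ec_concat f g}),
      one = ec_homotopy_rel X \<kappa> x0 `` {\<lambda>_. x0}\<rparr>"

end

theory Submission
  imports Defs
begin

text \<open>
  A loop has finite range, so it lies in some \<open>X\<^sub>j\<close>, and the isomorphism sends \<open>[f]\<close> to
  \<open>[f\<^sub>j \<circ> f]\<close>. The homotopies between \<open>f\<^sub>w\<close> restricted to \<open>X\<^sub>v\<close> and \<open>f\<^sub>v\<close> make this
  independent of \<open>j\<close>; a homotopy of loops, having finitely many stages, also lies in some \<open>X\<^sub>j\<close>.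
  The maps \<open>g\<^sub>j\<close> give the inverse in the same way, because \<open>g\<^sub>j \<circ> f\<^sub>j\<close> and \<open>f\<^sub>j \<circ> g\<^sub>j\<close> are
  homotopic to identities.

  Homotopy of loops is the transitive closure of the one-step relation under which \<open>f n\<close> and \<open>g n\<close>
  are equal or adjacent for all \<open>n\<close>, which reduces all the verifications to a single step.
\<close>

section \<open>Continuity as a pointwise condition on adjacent points\<close>

definition near :: "('a \<Rightarrow> 'a \<Rightarrow> bool) \<Rightarrow> 'a \<Rightarrow> 'a \<Rightarrow> bool" where
  "near \<kappa> x y \<longleftrightarrow> x = y \<or> \<kappa> x y"

lemma near_refl [simp]: "near \<kappa> x x"
  by (simp add: near_def)

lemma near_sym:
  assumes "symp_on X \<kappa>" "x \<in> X" "y \<in> X" "near \<kappa> x y"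
  shows "near \<kappa> y x"
  using assms by (auto simp: near_def symp_on_def)

lemma path_imp_rtrancl:
  assumes "p \<noteq> []" "set p \<subseteq> A" "successively \<kappa> p"
  shows "(hd p, last p) \<in> {(a, b). a \<in> A \<and> b \<in> A \<and> \<kappa> a b}\<^sup>*"
  using assms
proof (induction p rule: induct_list012)
  case (3 x y zs)
  have "(x, y) \<in> {(a, b). a \<in> A \<and> b \<in> A \<and> \<kappa> a b}" using 3 by auto
  moreover have "(y, last (y # zs)) \<in> {(a, b). a \<in> A \<and> b \<in> A \<and> \<kappa> a b}\<^sup>*"
    using 3 by auto
  ultimately show ?case by (auto intro: converse_rtrancl_into_rtrancl)
qed auto

lemma rtrancl_imp_path:
  assumes "(x, y) \<in> {(a, b). a \<in> A \<and> b \<in> A \<and> \<kappa> a b}\<^sup>*" "x \<in> A"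
  shows "\<exists>p. p \<noteq> [] \<and> hd p = x \<and> last p = y \<and> set p \<subseteq> A \<and> successively \<kappa> p"
  using assms
proof (induction rule: rtrancl_induct)
  case base
  then show ?case by (intro exI[of _ "[x]"]) auto
next
  case (step y z)
  then obtain p where "p \<noteq> []" "hd p = x" "last p = y" "set p \<subseteq> A" "successively \<kappa> p"
    by blast
  with step(2) show ?case
    by (intro exI[of _ "p @ [z]"]) (auto simp: successively_append_iff)
qed

text \<open>Replaces lists by a closure, so later arguments become inductions along a path. The
  exception for equal points disappears because the closure is reflexive.\<close>

lemma digi_connected_rtrancl:
  "digi_connected \<kappa> A \<longleftrightarrow>
     (\<forall>x\<in>A. \<forall>y\<in>A. (x, y) \<in> {(a, b). a \<in> A \<and> b \<in> A \<and> \<kappa> a b}\<^sup>*)"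
proof
  assume c: "digi_connected \<kappa> A"
  show "\<forall>x\<in>A. \<forall>y\<in>A. (x, y) \<in> {(a, b). a \<in> A \<and> b \<in> A \<and> \<kappa> a b}\<^sup>*"
  proof (intro ballI)
    fix x y assume "x \<in> A" "y \<in> A"
    show "(x, y) \<in> {(a, b). a \<in> A \<and> b \<in> A \<and> \<kappa> a b}\<^sup>*"
    proof (cases "x = y")
      case False
      then obtain p where "p \<noteq> []" "hd p = x" "last p = y" "set p \<subseteq> A" "successively \<kappa> p"
        using c \<open>x \<in> A\<close> \<open>y \<in> A\<close> unfolding digi_connected_def by blast
      then show ?thesis using path_imp_rtrancl[of p A \<kappa>] by simp
    qed simp
  qed
next
  assume "\<forall>x\<in>A. \<forall>y\<in>A. (x, y) \<in> {(a, b). a \<in> A \<and> b \<in> A \<and> \<kappa> a b}\<^sup>*"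
  then show "digi_connected \<kappa> A"
    unfolding digi_connected_def by (intro ballI impI rtrancl_imp_path) auto
qed

text \<open>A path starting at \<open>a\<close> can leave \<open>a\<close> only by a step to
  \<open>b\<close>. Without adjacency it stays at \<open>a\<close>, which forces
  \<open>b = a\<close>.\<close>

lemma digi_connected_pair_imp_near:
  assumes "digi_connected \<kappa> {a, b}"
  shows "near \<kappa> a b"
proof (rule ccontr)
  assume n: "\<not> near \<kappa> a b"
  have "(a, b) \<in> {(u, v). u \<in> {a, b} \<and> v \<in> {a, b} \<and> \<kappa> u v}\<^sup>*"
    using assms unfolding digi_connected_rtrancl by blast
  then have "b = a"
    by (induction rule: rtrancl_induct) (use n in \<open>auto simp: near_def\<close>)
  with n show False by (simp add: near_def)
qed

text \<open>Forwards, the definition is tested on the connected set \<open>{x, y}\<close>.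
  Backwards, the image of a path is a path once repeated points are dropped, which the reflexive
  closure does by itself.\<close>

lemma digi_continuous_iff_near:
  assumes "symp_on X \<kappa>"
  shows "digi_continuous X \<kappa> Y \<mu> f \<longleftrightarrow>
           f ` X \<subseteq> Y \<and> (\<forall>x\<in>X. \<forall>y\<in>X. \<kappa> x y \<longrightarrow> near \<mu> (f x) (f y))"
proof safe
  fix x y assume c: "digi_continuous X \<kappa> Y \<mu> f" and xy: "x \<in> X" "y \<in> X" "\<kappa> x y"
  \<comment> \<open>Connectedness of \<open>{x, y}\<close> asks for paths in both directions, so the
    reversed edge is required as well.\<close>
  have "\<kappa> y x" using assms xy by (auto simp: symp_on_def)
  then have "digi_connected \<kappa> {x, y}"
    using xy unfolding digi_connected_rtrancl by (blast intro: r_into_rtrancl)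
  then have "digi_connected \<mu> (f ` {x, y})"
    using c xy unfolding digi_continuous_def by (meson empty_subsetI insert_subset)
  then show "near \<mu> (f x) (f y)"
    by (intro digi_connected_pair_imp_near) simp
next
  assume sub: "f ` X \<subseteq> Y" and nr: "\<forall>x\<in>X. \<forall>y\<in>X. \<kappa> x y \<longrightarrow> near \<mu> (f x) (f y)"
  have "digi_connected \<mu> (f ` A)" if A: "A \<subseteq> X" "digi_connected \<kappa> A" for A
  proof -
    have "(f x, f y) \<in> {(a, b). a \<in> f ` A \<and> b \<in> f ` A \<and> \<mu> a b}\<^sup>*"
      if "(x, y) \<in> {(a, b). a \<in> A \<and> b \<in> A \<and> \<kappa> a b}\<^sup>*" for x y
      using that
    proof (induction rule: rtrancl_induct)
      case (step y z)
      then have yz: "y \<in> A" "z \<in> A" and "near \<mu> (f y) (f z)"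
        using nr A by auto
      then consider "f y = f z" | "\<mu> (f y) (f z)" unfolding near_def by blast
      then show ?case
      proof cases
        case 2
        with yz have "(f y, f z) \<in> {(a, b). a \<in> f ` A \<and> b \<in> f ` A \<and> \<mu> a b}" by blast
        with step.IH show ?thesis by (rule rtrancl_into_rtrancl)
      qed (use step.IH in simp)
    qed simp
    with A(2) show ?thesis unfolding digi_connected_rtrancl by blast
  qed
  with sub show "digi_continuous X \<kappa> Y \<mu> f" unfolding digi_continuous_def by blast
qed (auto simp: digi_continuous_def)

lemma digi_continuous_near:
  assumes "digi_continuous X \<kappa> Y \<mu> f" "symp_on X \<kappa>" "x \<in> X" "y \<in> X" "near \<kappa> x y"
  shows "near \<mu> (f x) (f y)"
  using assms digi_continuous_iff_near[of X \<kappa> Y \<mu> f] by (auto simp: near_def[of \<kappa>])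

lemma symp_on_nat_adj: "symp_on A nat_adj"
  by (auto simp: symp_on_def nat_adj_def)

lemma digi_continuous_nat:
  assumes "symp_on X \<kappa>"
  shows "digi_continuous UNIV nat_adj X \<kappa> f \<longleftrightarrow>
           range f \<subseteq> X \<and> (\<forall>n. near \<kappa> (f n) (f (Suc n)))"
  unfolding digi_continuous_iff_near[OF symp_on_nat_adj]
  by (auto simp: nat_adj_def intro: near_sym[OF assms])

lemma digi_continuous_interval:
  assumes "symp_on X \<kappa>"
  shows "digi_continuous {0..m} nat_adj X \<kappa> f \<longleftrightarrow>
           f ` {0..m} \<subseteq> X \<and> (\<forall>n<m. near \<kappa> (f n) (f (Suc n)))"
proof safe
  fix n assume "digi_continuous {0..m} nat_adj X \<kappa> f" "n < m"
  then show "near \<kappa> (f n) (f (Suc n))"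
    using digi_continuous_near[OF _ symp_on_nat_adj, of "{0..m}" X \<kappa> f n "Suc n"]
    by (simp add: near_def[of nat_adj] nat_adj_def)
next
  assume "f ` {0..m} \<subseteq> X" "\<forall>n<m. near \<kappa> (f n) (f (Suc n))"
  then show "digi_continuous {0..m} nat_adj X \<kappa> f"
    unfolding digi_continuous_iff_near[OF symp_on_nat_adj]
    by (auto simp: nat_adj_def image_subset_iff Suc_le_eq intro: near_sym[OF assms])
qed (auto simp: digi_continuous_def)

section \<open>Joining at a prescribed time, and single homotopy steps\<close>

text \<open>The junction is a free parameter here, since \<open>ec_length f\<close> may change when
  \<open>f\<close> is deformed or composed with a map.\<close>

definition concat_at :: "nat \<Rightarrow> (nat \<Rightarrow> 'a) \<Rightarrow> (nat \<Rightarrow> 'a) \<Rightarrow> nat \<Rightarrow> 'a" where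
  "concat_at M f g n = (if n \<le> M then f n else g (n - M))"

lemma ec_concat_eq_concat_at: "ec_concat f g = concat_at (ec_length f) f g"
  by (auto simp: ec_concat_def concat_at_def)

text \<open>With prescribed junctions associativity is an equality, so for \<open>ec_concat\<close>
  only the junctions have to be moved.\<close>

lemma concat_at_assoc:
  "concat_at (M + K) (concat_at M f g) h = concat_at M f (concat_at K g h)"
  by (auto simp: concat_at_def fun_eq_iff)

lemma comp_concat_at: "p \<circ> concat_at M f g = concat_at M (p \<circ> f) (p \<circ> g)"
  by (auto simp: concat_at_def)

definition ec_step ::
    "'a set \<Rightarrow> ('a \<Rightarrow> 'a \<Rightarrow> bool) \<Rightarrow> 'a \<Rightarrow> ((nat \<Rightarrow> 'a) \<times> (nat \<Rightarrow> 'a)) set" where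
  "ec_step X \<kappa> x0 =
     {(f, g). f \<in> ec_loops X \<kappa> x0 \<and> g \<in> ec_loops X \<kappa> x0 \<and> (\<forall>n. near \<kappa> (f n) (g n))}"

section \<open>Loops at a base point and their homotopy relation\<close>

locale pointed_image =
  fixes X :: "'a set" and \<kappa> :: "'a \<Rightarrow> 'a \<Rightarrow> bool" and x0 :: 'a
  assumes sym: "symp_on X \<kappa>" and base: "x0 \<in> X"
begin

abbreviation "loops \<equiv> ec_loops X \<kappa> x0"
abbreviation "rel \<equiv> ec_homotopy_rel X \<kappa> x0"
abbreviation "one_step \<equiv> ec_step X \<kappa> x0"
abbreviation "\<pi> \<equiv> fundamental_group X \<kappa> x0"

text \<open>Eliminates the definite description in \<open>ec_value\<close>: any two constant tails
  overlap, so the eventual value is unique.\<close>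

lemma loops_iff:
  "f \<in> loops \<longleftrightarrow> range f \<subseteq> X \<and> (\<forall>n. near \<kappa> (f n) (f (Suc n))) \<and> f 0 = x0 \<and>
     (\<exists>m. \<forall>n\<ge>m. f n = x0)"
proof -
  have v: "ec_value f = c" if "\<forall>n\<ge>m. f n = c" for m c
    unfolding ec_value_def
  proof (rule the_equality)
    fix d assume "\<exists>m. \<forall>n\<ge>m. f n = d"
    then obtain k where "\<forall>n\<ge>k. f n = d" by blast
    with that show "d = c" by (metis linorder_linear)
  qed (use that in blast)
  show ?thesis
    unfolding ec_loops_def ec_path_def digi_continuous_nat[OF sym] mem_Collect_eq
    using v by (metis order_refl)
qed

lemma loopI:
  assumes "\<And>n. f n \<in> X" "\<And>n. near \<kappa> (f n) (f (Suc n))" "f 0 = x0" "\<And>n. n \<ge> m \<Longrightarrow> f n = x0"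
  shows "f \<in> loops"
  using assms unfolding loops_iff by blast

lemma loopD:
  assumes "f \<in> loops"
  shows "f n \<in> X" "near \<kappa> (f n) (f (Suc n))" "near \<kappa> (f (Suc n)) (f n)" "f 0 = x0"
  using assms near_sym[OF sym, of "f n" "f (Suc n)"] by (auto simp: loops_iff)

lemma loop_near:
  assumes "f \<in> loops" "a \<le> Suc b" "b \<le> Suc a"
  shows "near \<kappa> (f a) (f b)"
proof -
  have "a = b \<or> a = Suc b \<or> b = Suc a" using assms(2,3) by linarith
  then show ?thesis using loopD[OF assms(1)] by auto
qed

lemma ec_length_loop:
  assumes "f \<in> loops" "n \<ge> ec_length f"
  shows "f n = x0"
proof -
  obtain m where m: "\<forall>n\<ge>m. f n = x0" using assms by (auto simp: loops_iff)
  then have "\<forall>n\<ge>m. f n = f m" by simp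
  then have "\<forall>n\<ge>ec_length f. f n = f (ec_length f)"
    unfolding ec_length_def by (rule LeastI)
  with m assms(2) show ?thesis by (metis linorder_linear)
qed

lemma const_loop: "(\<lambda>_. x0) \<in> loops"
  using base by (auto simp: loops_iff)

text \<open>At the junction \<open>f M = x0 = g 0\<close>, so the step across it is the step of
  \<open>g\<close> from \<open>0\<close> to \<open>1\<close>. Whatever \<open>f\<close> does after
  \<open>M\<close> is cut off.\<close>

lemma concat_at_loop:
  assumes "f \<in> loops" "g \<in> loops" "f M = x0"
  shows "concat_at M f g \<in> loops"
proof -
  obtain k where k: "\<forall>n\<ge>k. g n = x0" using assms by (auto simp: loops_iff)
  have "near \<kappa> (concat_at M f g n) (concat_at M f g (Suc n))" for n
  proof -
    consider "n < M" | "n = M" | "n > M" by linarith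
    then show ?thesis
      using loopD(2)[OF assms(1), of n] loopD(2)[OF assms(2), of "n - M"] loopD(4)[OF assms(2)]
      by cases (auto simp: concat_at_def assms(3) Suc_diff_le)
  qed
  then show ?thesis
    using loopD[OF assms(1)] loopD[OF assms(2)] k
    by (intro loopI[of _ "Suc (M + k)"]) (auto simp: concat_at_def)
qed

lemma one_stepI:
  assumes "f \<in> loops" "g \<in> loops" "\<And>n. near \<kappa> (f n) (g n)"
  shows "(f, g) \<in> one_step"
  using assms by (simp add: ec_step_def)

text \<open>Consecutive slices of a homotopy are one step apart, and conversely a chain of
  \<open>k\<close> steps is a homotopy whose slices are the members of the chain.\<close>

lemma rel_eq_trancl: "rel = one_step\<^sup>+"
proof (intro equalityI subrelI)
  show "(f, g) \<in> rel" if fg: "(f, g) \<in> one_step\<^sup>+" for f g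
  proof -
    \<comment> \<open>The transitive, not reflexive, closure yields \<open>k > 0\<close>, as a
      homotopy must have positive duration.\<close>
    obtain k where k: "k > 0" "(f, g) \<in> one_step ^^ k" using fg trancl_power by blast
    then obtain H where H: "H 0 = f" "H k = g" "\<And>i. i < k \<Longrightarrow> (H i, H (Suc i)) \<in> one_step"
      unfolding relpow_fun_conv by blast
    have L: "H i \<in> loops" if "i \<le> k" for i
    proof (cases "i = k")
      case True
      with H(3)[of "k - 1"] k(1) show ?thesis by (auto simp: ec_step_def)
    next
      case False
      with H(3)[of i] that show ?thesis by (auto simp: ec_step_def)
    qed
    have fl: "f \<in> loops" "g \<in> loops" using L[of 0] L[of k] H by auto
    have c: "digi_continuous UNIV nat_adj X \<kappa> h" if "h \<in> loops" for h
      using that by (simp add: ec_loops_def ec_path_def)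
    have "digi_continuous {0..k} nat_adj X \<kappa> (\<lambda>s. H s n)" for n
      unfolding digi_continuous_interval[OF sym]
      using H(3) L by (auto simp: ec_step_def loopD)
    then have "ec_homotopy X \<kappa> f g k H"
      unfolding ec_homotopy_def digi_homotopy_def
      using c[OF L] fl c L H(1,2) k(1) by (auto simp: ec_loops_def)
    moreover have "holds_endpoints_fixed f g k H"
    proof -
      \<comment> \<open>The endpoint condition wants one tail common to all slices. There are
        finitely many, so the maximal length serves, and \<open>Suc\<close> ensures
        \<open>c \<ge> 1\<close>.\<close>
      define c where "c = Suc (Max ((\<lambda>s. ec_length (H s)) ` {0..k}))"
      have "H s n = x0" if "s \<in> {0..k}" "n \<ge> c" for s n
      proof (rule ec_length_loop)
        have "ec_length (H s) \<le> Max ((\<lambda>s. ec_length (H s)) ` {0..k})"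
          using that by (intro Max_ge) auto
        then show "ec_length (H s) \<le> n" using that unfolding c_def by linarith
      qed (use L that in auto)
      then have "\<forall>n\<ge>c. \<forall>s\<in>{0..k}. H s n = f n \<and> f n = g n"
        using H(1,2) by (metis atLeastAtMost_iff le0 order_refl)
      moreover have "c \<ge> 1" by (simp add: c_def)
      ultimately show ?thesis
        unfolding holds_endpoints_fixed_def using L fl by (auto simp: loopD)
    qed
    ultimately show ?thesis using fl by (auto simp: ec_homotopy_rel_def)
  qed
  show "(f, g) \<in> one_step\<^sup>+" if fg: "(f, g) \<in> rel" for f g
  proof -
    obtain k H where fl: "f \<in> loops" "g \<in> loops"
      and H: "ec_homotopy X \<kappa> f g k H" "holds_endpoints_fixed f g k H"
      using fg by (auto simp: ec_homotopy_rel_def)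
    then have k: "k > 0" and H0: "H 0 = f" "H k = g"
      by (auto simp: ec_homotopy_def digi_homotopy_def)
    obtain c where c: "\<forall>n\<ge>c. \<forall>s\<in>{0..k}. H s n = f n"
      using H(2) by (auto simp: holds_endpoints_fixed_def)
    have L: "H s \<in> loops" if "s \<le> k" for s
    proof -
      have "digi_continuous UNIV nat_adj X \<kappa> (H s)"
        using H(1) that by (simp add: ec_homotopy_def ec_path_def)
      moreover have "H s 0 = x0"
        using H(2) that loopD(4)[OF fl(1)] by (auto simp: holds_endpoints_fixed_def)
      \<comment> \<open>From \<open>c\<close> on the slice agrees with \<open>f\<close>, and from
        \<open>ec_length f\<close> on \<open>f\<close> rests at \<open>x0\<close>; the sum lies
        beyond both.\<close>
      moreover have "\<forall>n\<ge>c + ec_length f. H s n = x0"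
        using c that ec_length_loop[OF fl(1)] by auto
      ultimately show ?thesis unfolding loops_iff digi_continuous_nat[OF sym] by blast
    qed
    have "(H i, H (Suc i)) \<in> one_step" if "i < k" for i
    proof (rule one_stepI)
      fix n
      have "digi_continuous {0..k} nat_adj X \<kappa> (\<lambda>s. H s n)"
        using H(1) by (simp add: ec_homotopy_def digi_homotopy_def)
      then show "near \<kappa> (H i n) (H (Suc i) n)"
        using that unfolding digi_continuous_interval[OF sym] by blast
    qed (use L that in auto)
    then have "(f, g) \<in> one_step ^^ k" unfolding relpow_fun_conv using H0 by blast
    then show ?thesis using k trancl_power by blast
  qed
qed

lemma one_step_rel: "(f, g) \<in> one_step \<Longrightarrow> (f, g) \<in> rel"
  by (simp add: rel_eq_trancl)

lemma relD: "(f, g) \<in> rel \<Longrightarrow> f \<in> loops \<and> g \<in> loops"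
  by (auto simp: ec_homotopy_rel_def)

lemma rel_refl: "f \<in> loops \<Longrightarrow> (f, f) \<in> rel"
  by (intro one_step_rel one_stepI) auto

lemma rel_trans [trans]: "(f, g) \<in> rel \<Longrightarrow> (g, h) \<in> rel \<Longrightarrow> (f, h) \<in> rel"
  unfolding rel_eq_trancl by (rule trancl_trans)

lemma rel_sym: "(f, g) \<in> rel \<Longrightarrow> (g, f) \<in> rel"
proof -
  have "sym one_step"
    unfolding sym_def ec_step_def using near_sym[OF sym] loopD(1) by blast
  then show "(f, g) \<in> rel \<Longrightarrow> (g, f) \<in> rel"
    unfolding rel_eq_trancl by (metis sym_trancl symD)
qed

lemma equiv_rel: "equiv loops rel"
  by (intro equivI refl_onI symI transI) (auto dest: relD intro: rel_refl rel_sym rel_trans)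

text \<open>The form in which explicit homotopies enter below: a finite family of loops whose
  neighbours are pointwise near.\<close>

lemma rel_chain:
  fixes h :: "nat \<Rightarrow> nat \<Rightarrow> 'a"
  assumes "\<And>i. i \<le> k \<Longrightarrow> h i \<in> loops"
    and "\<And>i n. i < k \<Longrightarrow> near \<kappa> (h i n) (h (Suc i) n)"
  shows "(h 0, h k) \<in> rel"
  using assms
proof (induction k)
  case (Suc k)
  then have "(h 0, h k) \<in> rel" by simp
  also have "(h k, h (Suc k)) \<in> rel"
    using Suc.prems by (intro one_step_rel one_stepI) auto
  finally show ?case .
qed (simp add: rel_refl)

section \<open>Products and reverses up to homotopy\<close>

text \<open>
  A homotopy can change \<open>ec_length\<close>. Waiting one more step at the base point before starting \<open>g\<close>
  is a single homotopy step, so loops may be joined at any \<open>M \<ge> ec_length f\<close>.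
\<close>

lemma concat_at_Suc_rel:
  assumes "f \<in> loops" "g \<in> loops" "f M = x0" "f (Suc M) = x0"
  shows "(concat_at M f g, concat_at (Suc M) f g) \<in> rel"
proof (intro one_step_rel one_stepI)
  let ?h = "concat_at M f g"
  have h: "?h \<in> loops" using assms by (simp add: concat_at_loop)
  show "near \<kappa> (?h n) (concat_at (Suc M) f g n)" for n
  proof -
    \<comment> \<open>The delayed loop is \<open>?h\<close> read one step later after
      \<open>M\<close>; at \<open>n = Suc M\<close> this uses \<open>f (Suc M) = f M = x0\<close>.
      Consecutive values of \<open>?h\<close> are near.\<close>
    have "concat_at (Suc M) f g n = ?h (if n \<le> M then n else n - 1)"
      using assms by (auto simp: concat_at_def le_Suc_eq)
    then show ?thesis using loop_near[OF h] by auto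
  qed
qed (use assms in \<open>simp_all add: concat_at_loop\<close>)

lemma concat_at_rel_ec_concat:
  assumes "f \<in> loops" "g \<in> loops" "ec_length f \<le> M"
  shows "(concat_at M f g, ec_concat f g) \<in> rel"
  using assms(3)
proof (induction M rule: dec_induct)
  case base
  then show ?case
    using assms by (simp add: ec_concat_eq_concat_at rel_refl concat_at_loop ec_length_loop)
next
  case (step M)
  have "(concat_at (Suc M) f g, concat_at M f g) \<in> rel"
    using assms step by (intro rel_sym[OF concat_at_Suc_rel]) (auto intro: ec_length_loop)
  also note step.IH
  finally show ?case .
qed

lemma ec_concat_loop: "f \<in> loops \<Longrightarrow> g \<in> loops \<Longrightarrow> ec_concat f g \<in> loops"
  by (simp add: ec_concat_eq_concat_at concat_at_loop ec_length_loop)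

text \<open>\<open>f\<close> and \<open>f'\<close> may have different lengths, so both products are
  first moved to a common junction \<open>M\<close>, where nearness holds pointwise.\<close>

lemma ec_concat_step:
  assumes "(f, f') \<in> one_step" "(g, g') \<in> one_step"
  shows "(ec_concat f g, ec_concat f' g') \<in> rel"
proof -
  define M where "M = max (ec_length f) (ec_length f')"
  have l: "f \<in> loops" "f' \<in> loops" "g \<in> loops" "g' \<in> loops"
    using assms by (auto simp: ec_step_def)
  have "(ec_concat f g, concat_at M f g) \<in> rel"
    using l by (intro rel_sym[OF concat_at_rel_ec_concat]) (auto simp: M_def)
  also have "(concat_at M f g, concat_at M f' g') \<in> rel"
    using assms l
    by (intro one_step_rel one_stepI concat_at_loop)
      (auto simp: M_def ec_step_def concat_at_def intro: ec_length_loop)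
  also have "(concat_at M f' g', ec_concat f' g') \<in> rel"
    using l by (intro concat_at_rel_ec_concat) (auto simp: M_def)
  finally show ?thesis .
qed

text \<open>The chains for the two factors may differ in number of steps, so one factor is varied at
  a time, the other making the trivial step.\<close>

lemma ec_concat_rel_left:
  assumes "(f, f') \<in> rel" "g \<in> loops"
  shows "(ec_concat f g, ec_concat f' g) \<in> rel"
proof -
  have g: "(g, g) \<in> one_step" using assms by (intro one_stepI) auto
  show ?thesis
    using assms(1)[unfolded rel_eq_trancl]
    by (induction rule: trancl_induct)
      (auto intro: ec_concat_step[OF _ g] rel_trans)
qed

lemma ec_concat_rel_right:
  assumes "(g, g') \<in> rel" "f \<in> loops"
  shows "(ec_concat f g, ec_concat f g') \<in> rel"
proof -
  have f: "(f, f) \<in> one_step" using assms by (intro one_stepI) auto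
  show ?thesis
    using assms(1)[unfolded rel_eq_trancl]
    by (induction rule: trancl_induct)
      (auto intro: ec_concat_step[OF f] rel_trans)
qed

lemma ec_concat_rel:
  assumes "(f, f') \<in> rel" "(g, g') \<in> rel"
  shows "(ec_concat f g, ec_concat f' g') \<in> rel"
  using assms by (meson ec_concat_rel_left ec_concat_rel_right relD rel_trans)

lemma ec_concat_assoc_rel:
  assumes "f \<in> loops" "g \<in> loops" "h \<in> loops"
  shows "(ec_concat (ec_concat f g) h, ec_concat f (ec_concat g h)) \<in> rel"
proof -
  define M where "M = ec_length f"
  \<comment> \<open>The sum is an upper bound for two purposes: \<open>K\<close> is a legal junction
    after \<open>g\<close>, and \<open>M + K\<close> is one after
    \<open>ec_concat f g\<close>.\<close>
  define K where "K = ec_length g + ec_length (ec_concat f g)"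
  have fg: "ec_concat f g = concat_at M f g" by (simp add: M_def ec_concat_eq_concat_at)
  have "(ec_concat (ec_concat f g) h, concat_at (M + K) (ec_concat f g) h) \<in> rel"
    using assms by (intro rel_sym[OF concat_at_rel_ec_concat]) (auto simp: K_def ec_concat_loop)
  also have "concat_at (M + K) (ec_concat f g) h = ec_concat f (concat_at K g h)"
    unfolding fg concat_at_assoc by (simp add: M_def ec_concat_eq_concat_at)
  also have "(ec_concat f (concat_at K g h), ec_concat f (ec_concat g h)) \<in> rel"
    using assms by (intro ec_concat_rel_right concat_at_rel_ec_concat) (auto simp: K_def)
  finally show ?thesis .
qed

text \<open>
  The reverse of \<open>f\<close> is \<open>n \<mapsto> f (M - n)\<close>, where truncated subtraction makes it constant from \<open>M\<close>
  on. The product of \<open>f\<close> with its reverse is \<open>f\<close> applied to a tent function, which is cut off at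
  increasing heights \<open>s\<close>.
\<close>

lemma concat_reverse_rel:
  assumes "f \<in> loops"
  shows "(\<lambda>_. x0, concat_at M f (\<lambda>n. f (M - n))) \<in> rel"
proof -
  \<comment> \<open>The tent never exceeds \<open>M\<close>, so the cut at height \<open>M\<close>
    has no effect, and truncated subtraction keeps it at \<open>0\<close> from \<open>2 * M\<close>
    on. Its cut value changes by at most one with \<open>n\<close> or with \<open>s\<close>.\<close>
  define h where "h s n = f (min (min n (2 * M - n)) s)" for s n
  have "h s \<in> loops" for s
  proof -
    have "near \<kappa> (h s n) (h s (Suc n))" for n
      unfolding h_def by (rule loop_near[OF assms]) auto
    then show ?thesis
      using loopD[OF assms] by (intro loopI[of _ "2 * M"]) (auto simp: h_def)
  qed
  moreover have "near \<kappa> (h s n) (h (Suc s) n)" for s n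
    unfolding h_def by (rule loop_near[OF assms]) auto
  ultimately have "(h 0, h M) \<in> rel" by (intro rel_chain)
  moreover have "h 0 = (\<lambda>_. x0)" using loopD(4)[OF assms] by (auto simp: h_def)
  moreover have "h M = concat_at M f (\<lambda>n. f (M - n))"
    by (auto simp: h_def concat_at_def fun_eq_iff intro!: arg_cong[of _ _ f])
  ultimately show ?thesis by simp
qed

lemma reverse_loop:
  assumes "f \<in> loops" "f M = x0"
  shows "(\<lambda>n. f (M - n)) \<in> loops"
proof -
  have "near \<kappa> (f (M - n)) (f (M - Suc n))" for n
    by (rule loop_near[OF assms(1)]) auto
  then show ?thesis using loopD[OF assms(1)] assms(2) by (intro loopI[of _ M]) auto
qed

text \<open>The inverse is the reverse \<open>g\<close> of \<open>f\<close>. Since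
  \<open>groupI\<close> asks for a left inverse, \<open>concat_reverse_rel\<close> is applied to
  \<open>g\<close>, whose own reverse is \<open>f\<close>.\<close>

lemma left_inverse_rel:
  assumes "f \<in> loops"
  shows "\<exists>g\<in>loops. (ec_concat g f, \<lambda>_. x0) \<in> rel"
proof -
  define M where "M = ec_length f"
  define g where "g = (\<lambda>n. f (M - n))"
  have fM: "f n = x0" if "n \<ge> M" for n
    using that ec_length_loop[OF assms] by (simp add: M_def)
  have g: "g \<in> loops" unfolding g_def using assms fM by (intro reverse_loop) auto
  have gM: "g n = x0" if "n \<ge> M" for n
    using that loopD(4)[OF assms] by (simp add: g_def)
  have "ec_length g \<le> M"
    unfolding ec_length_def by (intro Least_le) (use gM in auto)
  then have "(ec_concat g f, concat_at M g f) \<in> rel"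
    by (intro rel_sym[OF concat_at_rel_ec_concat] g assms)
  \<comment> \<open>For \<open>n > M\<close> truncation gives \<open>g 0 = f M = x0\<close>, which
    equals \<open>f n\<close> because \<open>f\<close> has already stopped.\<close>
  also have "f = (\<lambda>n. g (M - n))"
  proof
    fix n
    show "f n = g (M - n)"
      using fM[of n] fM[of M] by (cases "n \<le> M") (auto simp: g_def)
  qed
  then have "(concat_at M g f, \<lambda>_. x0) \<in> rel"
    using rel_sym[OF concat_reverse_rel[OF g, of M]] by simp
  finally show ?thesis using g by blast
qed

section \<open>The group of loop classes\<close>

lemma carrier_fundamental_group: "carrier \<pi> = loops // rel"
  by (simp add: fundamental_group_def)

lemma one_fundamental_group: "\<one>\<^bsub>\<pi>\<^esub> = rel `` {\<lambda>_. x0}"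
  by (simp add: fundamental_group_def)

lemma class_in_carrier: "f \<in> loops \<Longrightarrow> rel `` {f} \<in> carrier \<pi>"
  by (simp add: carrier_fundamental_group quotientI)

lemma class_eqI: "(f, g) \<in> rel \<Longrightarrow> rel `` {f} = rel `` {g}"
  by (rule equiv_class_eq[OF equiv_rel])

lemma carrierE:
  assumes "A \<in> carrier \<pi>"
  obtains f where "f \<in> loops" "A = rel `` {f}"
  using assms by (auto simp: carrier_fundamental_group elim: quotientE)

text \<open>By congruence all members of the union that defines \<open>mult\<close> coincide, so it
  collapses to a single class.\<close>

lemma mult_class:
  assumes "f \<in> loops" "g \<in> loops"
  shows "rel `` {f} \<otimes>\<^bsub>\<pi>\<^esub> rel `` {g} = rel `` {ec_concat f g}"
proof -
  have "congruent2 rel rel (\<lambda>f g. rel `` {ec_concat f g})"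
    unfolding congruent2_def by (auto intro!: class_eqI ec_concat_rel)
  then show ?thesis
    using UN_equiv_class2[OF equiv_rel equiv_rel _ assms] by (simp add: fundamental_group_def)
qed

lemma group_fundamental_group: "group \<pi>"
proof (rule groupI)
  fix A B assume "A \<in> carrier \<pi>" "B \<in> carrier \<pi>"
  then show "A \<otimes>\<^bsub>\<pi>\<^esub> B \<in> carrier \<pi>"
    by (auto elim!: carrierE simp: mult_class ec_concat_loop class_in_carrier)
next
  show "\<one>\<^bsub>\<pi>\<^esub> \<in> carrier \<pi>"
    by (simp add: one_fundamental_group class_in_carrier const_loop)
next
  fix A B C assume "A \<in> carrier \<pi>" "B \<in> carrier \<pi>" "C \<in> carrier \<pi>"
  then show "A \<otimes>\<^bsub>\<pi>\<^esub> B \<otimes>\<^bsub>\<pi>\<^esub> C = A \<otimes>\<^bsub>\<pi>\<^esub> (B \<otimes>\<^bsub>\<pi>\<^esub> C)"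
    by (auto elim!: carrierE
        simp: mult_class ec_concat_loop class_eqI[OF ec_concat_assoc_rel])
next
  fix A assume "A \<in> carrier \<pi>"
  then obtain f where f: "f \<in> loops" "A = rel `` {f}" by (rule carrierE)
  \<comment> \<open>With length \<open>0\<close> the constant loop contributes only its value at
    \<open>0\<close>, so the unit law holds as an equality of loops.\<close>
  have "ec_length (\<lambda>_. x0) = 0" unfolding ec_length_def by (rule Least_equality) auto
  then have "ec_concat (\<lambda>_. x0) f = f"
    using loopD(4)[OF f(1)] by (auto simp: ec_concat_def fun_eq_iff)
  then show "\<one>\<^bsub>\<pi>\<^esub> \<otimes>\<^bsub>\<pi>\<^esub> A = A"
    using f by (simp add: one_fundamental_group mult_class const_loop)
  obtain g where g: "g \<in> loops" "(ec_concat g f, \<lambda>_. x0) \<in> rel"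
    using left_inverse_rel[OF f(1)] by blast
  then have "rel `` {g} \<otimes>\<^bsub>\<pi>\<^esub> A = \<one>\<^bsub>\<pi>\<^esub>"
    using f by (simp add: one_fundamental_group mult_class class_eqI)
  with g(1) show "\<exists>B\<in>carrier \<pi>. B \<otimes>\<^bsub>\<pi>\<^esub> A = \<one>\<^bsub>\<pi>\<^esub>"
    using class_in_carrier by blast
qed

lemma finite_range_loop:
  assumes "f \<in> loops"
  shows "finite (range f)"
proof -
  have "range f \<subseteq> insert x0 (f ` {..<ec_length f})"
    using ec_length_loop[OF assms] by (auto simp: not_less[symmetric])
  then show ?thesis by (rule finite_subset) simp
qed

end

section \<open>Loops under pointed maps and pointed homotopies\<close>

text \<open>\<open>p\<close> is controlled only on \<open>A\<close>, hence the condition on the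
  range of \<open>f\<close>. The result is read in all of \<open>Y\<close>, so that images from
  different stages can be compared.\<close>

lemma comp_loop:
  assumes "pointed_image X \<kappa> x0" "pointed_image Y \<mu> y0" "A \<subseteq> X" "B \<subseteq> Y"
    and p: "digi_continuous A \<kappa> B \<mu> p" "p x0 = y0"
    and f: "f \<in> ec_loops X \<kappa> x0" "range f \<subseteq> A"
  shows "p \<circ> f \<in> ec_loops Y \<mu> y0"
proof -
  interpret X: pointed_image X \<kappa> x0 by fact
  interpret Y: pointed_image Y \<mu> y0 by fact
  have "symp_on A \<kappa>" using X.sym assms(3) by (rule symp_on_subset)
  then have "near \<mu> (p (f n)) (p (f (Suc n)))" for n
    using digi_continuous_near[OF p(1)] X.loopD[OF f(1)] f(2) by blast
  moreover have "p (f n) \<in> Y" for n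
    using p(1) f(2) assms(4) by (auto simp: digi_continuous_def)
  ultimately show ?thesis
    using X.loopD(4)[OF f(1)] X.ec_length_loop[OF f(1)] p(2)
    by (intro Y.loopI[of _ "ec_length f"]) auto
qed

text \<open>Composing \<open>f\<close> with the time slices of the homotopy gives a chain of loops:
  the slices fix the base point, and continuity in time makes consecutive ones near.\<close>

lemma comp_pointed_homotopic:
  assumes "pointed_image X \<kappa> x0" "pointed_image Y \<mu> y0" "A \<subseteq> X" "B \<subseteq> Y"
    and pq: "pointed_homotopic A \<kappa> B \<mu> x0 p q" "p x0 = y0"
    and f: "f \<in> ec_loops X \<kappa> x0" "range f \<subseteq> A"
  shows "(p \<circ> f, q \<circ> f) \<in> ec_homotopy_rel Y \<mu> y0"
proof -
  interpret X: pointed_image X \<kappa> x0 by fact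
  interpret Y: pointed_image Y \<mu> y0 by fact
  have "symp_on A \<kappa>" using X.sym assms(3) by (rule symp_on_subset)
  have symB: "symp_on B \<mu>" using Y.sym assms(4) by (rule symp_on_subset)
  have x0: "x0 \<in> A" using X.loopD(4)[OF f(1)] f(2) by blast
  obtain m F where F: "digi_homotopy A \<kappa> B \<mu> p q m F" "\<forall>t\<in>{0..m}. F x0 t = F x0 0"
    using pq(1) by (auto simp: pointed_homotopic_def)
  define h where "h t n = F (f n) t" for t n
  have "(h 0, h m) \<in> ec_homotopy_rel Y \<mu> y0"
  proof (rule Y.rel_chain)
    fix t assume t: "t \<le> m"
    have "F x0 t = y0"
      using F x0 pq(2) t by (auto simp: digi_homotopy_def)
    moreover have "digi_continuous A \<kappa> B \<mu> (\<lambda>x. F x t)"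
      using F t by (auto simp: digi_homotopy_def)
    ultimately have "(\<lambda>x. F x t) \<circ> f \<in> ec_loops Y \<mu> y0"
      using comp_loop[OF assms(1-4) _ _ f] by blast
    then show "h t \<in> ec_loops Y \<mu> y0" by (simp add: h_def[abs_def] comp_def)
  next
    fix t n assume t: "t < m"
    have "digi_continuous {0..m} nat_adj B \<mu> (\<lambda>t. F (f n) t)"
      using F f(2) by (auto simp: digi_homotopy_def)
    then show "near \<mu> (h t n) (h (Suc t) n)"
      using t unfolding digi_continuous_interval[OF symB] by (simp add: h_def)
  qed
  moreover have "h 0 = p \<circ> f" "h m = q \<circ> f"
    using F f(2) by (auto simp: h_def fun_eq_iff digi_homotopy_def)
  ultimately show ?thesis by simp
qed

section \<open>The isomorphism induced by a homotopic similarity\<close>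

text \<open>The union over representatives avoids a choice; it is a single class once
  \<open>\<Phi>\<close> respects the relations.\<close>

definition class_map ::
    "('b \<times> 'b) set \<Rightarrow> ('a \<Rightarrow> 'b) \<Rightarrow> 'a set \<Rightarrow> 'b set" where
  "class_map r \<Phi> A = (\<Union>f\<in>A. r `` {\<Phi> f})"

locale similarity =
  X: pointed_image X \<kappa> x1 + Y: pointed_image Y \<mu> y1
  for X :: "'a set" and \<kappa> x1 and Y :: "'b set" and \<mu> y1 +
  fixes Xs :: "nat \<Rightarrow> 'a set" and Ys :: "nat \<Rightarrow> 'b set"
    and fs :: "nat \<Rightarrow> 'a \<Rightarrow> 'b" and gs :: "nat \<Rightarrow> 'b \<Rightarrow> 'a"
  assumes mono: "\<And>j. j \<ge> 1 \<Longrightarrow> Xs j \<subseteq> Xs (Suc j)" "\<And>j. j \<ge> 1 \<Longrightarrow> Ys j \<subseteq> Ys (Suc j)"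
    and union: "X = (\<Union>j\<in>{1..}. Xs j)" "Y = (\<Union>j\<in>{1..}. Ys j)"
    and cont: "\<And>j. j \<ge> 1 \<Longrightarrow> digi_continuous (Xs j) \<kappa> (Ys j) \<mu> (fs j)"
      "\<And>j. j \<ge> 1 \<Longrightarrow> digi_continuous (Ys j) \<mu> (Xs j) \<kappa> (gs j)"
    and pointed: "\<And>j. j \<ge> 1 \<Longrightarrow> fs j x1 = y1" "\<And>j. j \<ge> 1 \<Longrightarrow> gs j y1 = x1"
    and homotopy_id:
      "\<And>j. j \<ge> 1 \<Longrightarrow> pointed_homotopic (Xs j) \<kappa> (Xs j) \<kappa> x1 (gs j \<circ> fs j) id"
      "\<And>j. j \<ge> 1 \<Longrightarrow> pointed_homotopic (Ys j) \<mu> (Ys j) \<mu> y1 (fs j \<circ> gs j) id"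
    and homotopy_le:
      "\<And>v w. v \<ge> 1 \<Longrightarrow> v \<le> w \<Longrightarrow> pointed_homotopic (Xs v) \<kappa> (Ys v) \<mu> x1 (fs w) (fs v)"
      "\<And>v w. v \<ge> 1 \<Longrightarrow> v \<le> w \<Longrightarrow> pointed_homotopic (Ys v) \<mu> (Xs v) \<kappa> y1 (gs w) (gs v)"
begin

text \<open>The assumptions are symmetric in the two images, so every result about \<open>fs\<close>
  also holds for \<open>gs\<close>; this supplies the inverse.\<close>

lemma swap: "similarity Y \<mu> y1 X \<kappa> x1 Ys Xs gs fs"
  using mono union cont pointed homotopy_id homotopy_le
  by unfold_locales auto

lemma Xs_mono:
  assumes "1 \<le> v" "v \<le> w"
  shows "Xs v \<subseteq> Xs w"
  using assms(2)
proof (induction w rule: dec_induct)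
  case (step w)
  then show ?case using mono(1)[of w] assms(1) by auto
qed simp

lemma stage_subset: "j \<ge> 1 \<Longrightarrow> Xs j \<subseteq> X" "j \<ge> 1 \<Longrightarrow> Ys j \<subseteq> Y"
  using union by auto

lemma loop_in_stage:
  assumes "f \<in> X.loops"
  shows "\<exists>j\<ge>1. range f \<subseteq> Xs j"
proof -
  have "\<exists>j\<ge>1. B \<subseteq> Xs j" if "finite B" "B \<subseteq> X" for B
    using that
  proof (induction rule: finite_induct)
    case (insert b B)
    then obtain i j where ij: "i \<ge> 1" "b \<in> Xs i" "j \<ge> 1" "B \<subseteq> Xs j"
      using union by auto
    then have "insert b B \<subseteq> Xs (max i j)"
      using Xs_mono[of i "max i j"] Xs_mono[of j "max i j"] by auto
    then show ?case using ij by (intro exI[of _ "max i j"]) auto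
  qed auto
  then show ?thesis
    using X.finite_range_loop[OF assms] X.loopD(1)[OF assms] by blast
qed

text \<open>Minimality gives \<open>stage f \<le> j\<close> for every admissible \<open>j\<close>,
  the order in which \<open>homotopy_le\<close> compares \<open>fs j\<close> with
  \<open>fs (stage f)\<close>.\<close>

definition stage :: "(nat \<Rightarrow> 'a) \<Rightarrow> nat" where
  "stage f = (LEAST j. j \<ge> 1 \<and> range f \<subseteq> Xs j)"

definition \<Phi> :: "(nat \<Rightarrow> 'a) \<Rightarrow> nat \<Rightarrow> 'b" where
  "\<Phi> f = fs (stage f) \<circ> f"

lemma stage:
  assumes "f \<in> X.loops"
  shows "stage f \<ge> 1" "range f \<subseteq> Xs (stage f)"
  using LeastI_ex[OF loop_in_stage[OF assms]] by (auto simp: stage_def)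

lemma comp_fs_loop:
  assumes "f \<in> X.loops" "j \<ge> 1" "range f \<subseteq> Xs j"
  shows "fs j \<circ> f \<in> Y.loops"
  using assms stage_subset cont(1) pointed(1)
  by (intro comp_loop[OF X.pointed_image_axioms Y.pointed_image_axioms, of "Xs j" "Ys j"]) auto

lemma \<Phi>_loop: "f \<in> X.loops \<Longrightarrow> \<Phi> f \<in> Y.loops"
  unfolding \<Phi>_def by (intro comp_fs_loop stage)

text \<open>Any stage containing the loop yields the same class, so several loops can be treated in
  a common stage.\<close>

lemma \<Phi>_rel:
  assumes "f \<in> X.loops" "j \<ge> 1" "range f \<subseteq> Xs j"
  shows "(\<Phi> f, fs j \<circ> f) \<in> Y.rel"
proof -
  have "stage f \<le> j" unfolding stage_def by (rule Least_le) (use assms in auto)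
  with stage[OF assms(1)] show ?thesis
    unfolding \<Phi>_def using assms(1,2) stage_subset pointed(1)
    by (intro Y.rel_sym[OF comp_pointed_homotopic[OF X.pointed_image_axioms
            Y.pointed_image_axioms _ _ homotopy_le(1)]]) auto
qed

text \<open>In a stage containing both loops, continuity of \<open>fs j\<close> preserves nearness.
  Different steps of a chain may use different \<open>j\<close>.\<close>

lemma \<Phi>_cong_step:
  assumes "(f, g) \<in> X.one_step"
  shows "(\<Phi> f, \<Phi> g) \<in> Y.rel"
proof -
  have l: "f \<in> X.loops" "g \<in> X.loops" and nr: "\<And>n. near \<kappa> (f n) (g n)"
    using assms by (auto simp: ec_step_def)
  define j where "j = max (stage f) (stage g)"
  have j: "j \<ge> 1" using stage(1)[OF l(1)] by (simp add: j_def)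
  have r: "range f \<subseteq> Xs j" "range g \<subseteq> Xs j"
    using stage[OF l(1)] stage[OF l(2)] Xs_mono[of "stage f" j] Xs_mono[of "stage g" j]
    by (auto simp: j_def)
  have "(\<Phi> f, fs j \<circ> f) \<in> Y.rel" by (intro \<Phi>_rel l j r)
  also have "(fs j \<circ> f, fs j \<circ> g) \<in> Y.rel"
  proof (intro Y.one_step_rel Y.one_stepI comp_fs_loop l j r)
    have "symp_on (Xs j) \<kappa>" using X.sym stage_subset(1)[OF j] by (rule symp_on_subset)
    then show "near \<mu> ((fs j \<circ> f) n) ((fs j \<circ> g) n)" for n
      using digi_continuous_near[OF cont(1)[OF j]] nr r by (simp add: image_subset_iff)
  qed
  also have "(fs j \<circ> g, \<Phi> g) \<in> Y.rel" by (intro Y.rel_sym[OF \<Phi>_rel] l j r)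
  finally show ?thesis .
qed

lemma \<Phi>_cong:
  assumes "(f, g) \<in> X.rel"
  shows "(\<Phi> f, \<Phi> g) \<in> Y.rel"
  using assms[unfolded X.rel_eq_trancl]
  by (induction rule: trancl_induct)
    (auto intro: \<Phi>_cong_step Y.rel_trans)

lemma \<Phi>_concat:
  assumes "f \<in> X.loops" "g \<in> X.loops"
  shows "(\<Phi> (ec_concat f g), ec_concat (\<Phi> f) (\<Phi> g)) \<in> Y.rel"
proof -
  define j where "j = max (stage f) (stage g)"
  have j: "j \<ge> 1" using stage(1)[OF assms(1)] by (simp add: j_def)
  have r: "range f \<subseteq> Xs j" "range g \<subseteq> Xs j"
    using stage[OF assms(1)] stage[OF assms(2)] Xs_mono[of "stage f" j] Xs_mono[of "stage g" j]
    by (auto simp: j_def)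
  define M where "M = ec_length f"
  have fg: "ec_concat f g = concat_at M f g" by (simp add: M_def ec_concat_eq_concat_at)
  have "range (concat_at M f g) \<subseteq> Xs j" using r by (auto simp: concat_at_def)
  then have "(\<Phi> (ec_concat f g), fs j \<circ> concat_at M f g) \<in> Y.rel"
    using X.ec_concat_loop[OF assms] j unfolding fg by (intro \<Phi>_rel)
  also have "fs j \<circ> concat_at M f g = concat_at M (fs j \<circ> f) (fs j \<circ> g)"
    by (rule comp_concat_at)
  also have "(concat_at M (fs j \<circ> f) (fs j \<circ> g), ec_concat (fs j \<circ> f) (fs j \<circ> g)) \<in> Y.rel"
  proof (intro Y.concat_at_rel_ec_concat comp_fs_loop assms j r)
    \<comment> \<open>Composition with \<open>fs j\<close> can shorten \<open>f\<close>, so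
      \<open>M\<close> may exceed the new length; it is still a legal junction.\<close>
    show "ec_length (fs j \<circ> f) \<le> M"
      unfolding ec_length_def[of "fs j \<circ> f"]
      by (rule Least_le) (use X.ec_length_loop[OF assms(1)] in \<open>auto simp: M_def\<close>)
  qed
  also have "(ec_concat (fs j \<circ> f) (fs j \<circ> g), ec_concat (\<Phi> f) (\<Phi> g)) \<in> Y.rel"
    by (intro Y.ec_concat_rel Y.rel_sym[OF \<Phi>_rel] assms j r)
  finally show ?thesis .
qed

text \<open>\<open>\<Phi> f\<close> may already lie in an earlier stage than \<open>f\<close> does,
  so \<open>\<Phi>_rel\<close> for the swapped data first replaces its map by \<open>gs j\<close>
  with \<open>j = stage f\<close>. Then \<open>gs j \<circ> fs j\<close> is deformed to the
  identity.\<close>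

lemma gs_\<Phi>_rel:
  assumes "f \<in> X.loops"
  shows "(similarity.\<Phi> Ys gs (\<Phi> f), f) \<in> X.rel"
proof -
  interpret S: similarity Y \<mu> y1 X \<kappa> x1 Ys Xs gs fs by (rule swap)
  define j where "j = stage f"
  have j: "j \<ge> 1" "range f \<subseteq> Xs j" using stage[OF assms] by (auto simp: j_def)
  have "range (\<Phi> f) \<subseteq> Ys j"
    using j cont(1)[OF j(1)] by (auto simp: \<Phi>_def j_def[symmetric] digi_continuous_def)
  then have "(S.\<Phi> (\<Phi> f), gs j \<circ> \<Phi> f) \<in> X.rel"
    by (intro S.\<Phi>_rel \<Phi>_loop assms j(1))
  also have "gs j \<circ> \<Phi> f = (gs j \<circ> fs j) \<circ> f" by (simp add: \<Phi>_def j_def comp_assoc)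
  also have "((gs j \<circ> fs j) \<circ> f, id \<circ> f) \<in> X.rel"
    using j assms stage_subset pointed
    by (intro comp_pointed_homotopic[OF X.pointed_image_axioms X.pointed_image_axioms
          _ _ homotopy_id(1)]) auto
  finally show ?thesis by simp
qed

abbreviation "induced \<equiv> class_map Y.rel \<Phi>"

lemma induced_class:
  assumes "f \<in> X.loops"
  shows "induced (X.rel `` {f}) = Y.rel `` {\<Phi> f}"
proof -
  have "congruent X.rel (\<lambda>f. Y.rel `` {\<Phi> f})"
    unfolding congruent_def by (auto intro!: Y.class_eqI \<Phi>_cong)
  then show ?thesis
    unfolding class_map_def by (intro UN_equiv_class[OF X.equiv_rel _ assms])
qed

lemma induced_carrier: "A \<in> carrier X.\<pi> \<Longrightarrow> induced A \<in> carrier Y.\<pi>"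
  by (auto elim!: X.carrierE simp: induced_class Y.class_in_carrier \<Phi>_loop)

lemma induced_hom: "induced \<in> hom X.\<pi> Y.\<pi>"
proof (rule homI)
  fix A B assume "A \<in> carrier X.\<pi>" "B \<in> carrier X.\<pi>"
  then show "induced (A \<otimes>\<^bsub>X.\<pi>\<^esub> B) = induced A \<otimes>\<^bsub>Y.\<pi>\<^esub> induced B"
    by (auto elim!: X.carrierE simp: X.mult_class Y.mult_class induced_class X.ec_concat_loop
        \<Phi>_loop Y.class_eqI[OF \<Phi>_concat])
qed (rule induced_carrier)

lemma induced_inverse:
  assumes "A \<in> carrier X.\<pi>"
  shows "class_map X.rel (similarity.\<Phi> Ys gs) (induced A) = A"
proof -
  interpret S: similarity Y \<mu> y1 X \<kappa> x1 Ys Xs gs fs by (rule swap)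
  show ?thesis
    using assms
    by (auto elim!: X.carrierE simp: induced_class S.induced_class \<Phi>_loop
        X.class_eqI[OF gs_\<Phi>_rel])
qed

lemma induced_iso: "induced \<in> iso X.\<pi> Y.\<pi>"
proof -
  interpret S: similarity Y \<mu> y1 X \<kappa> x1 Ys Xs gs fs by (rule swap)
  have "bij_betw induced (carrier X.\<pi>) (carrier Y.\<pi>)"
    \<comment> \<open>Both inverse laws are \<open>induced_inverse\<close>, once for the given data
      and once for the swapped ones.\<close>
    by (rule bij_betwI[of _ _ _ S.induced])
      (simp_all add: induced_carrier S.induced_carrier induced_inverse S.induced_inverse)
  with induced_hom show ?thesis by (simp add: iso_def)
qed

end

theorem theorem7p1:
  fixes X :: "(int ^ 'm) set" and \<kappa> :: "int ^ 'm \<Rightarrow> int ^ 'm \<Rightarrow> bool" and x1 :: "int ^ 'm"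
    and Y :: "(int ^ 'n) set" and \<mu> :: "int ^ 'n \<Rightarrow> int ^ 'n \<Rightarrow> bool" and y1 :: "int ^ 'n"
  assumes "digital_image X \<kappa>" and "digital_image Y \<mu>"
    and "x1 \<in> X" and "y1 \<in> Y"
    and "pointed_homotopically_similar X \<kappa> x1 Y \<mu> y1"
  shows "\<exists>F. group_hom (fundamental_group X \<kappa> x1) (fundamental_group Y \<mu> y1) F \<and>
             F \<in> iso (fundamental_group X \<kappa> x1) (fundamental_group Y \<mu> y1)"
proof -
  interpret X: pointed_image X \<kappa> x1
    using assms by unfold_locales (auto simp: digital_image_def)
  interpret Y: pointed_image Y \<mu> y1
    using assms by unfold_locales (auto simp: digital_image_def)
  obtain Xs Ys fs gs where "similarity X \<kappa> x1 Y \<mu> y1 Xs Ys fs gs"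
  proof -
    from assms(5) obtain Xs Ys fs gs where
      "\<forall>j\<ge>1. Xs j \<subseteq> Xs (Suc j) \<and> Ys j \<subseteq> Ys (Suc j)"
      "X = (\<Union>j\<in>{1..}. Xs j)" "Y = (\<Union>j\<in>{1..}. Ys j)"
      "\<forall>j\<ge>1. digi_continuous (Xs j) \<kappa> (Ys j) \<mu> (fs j) \<and>
         digi_continuous (Ys j) \<mu> (Xs j) \<kappa> (gs j) \<and> fs j x1 = y1 \<and> gs j y1 = x1 \<and>
         pointed_homotopic (Xs j) \<kappa> (Xs j) \<kappa> x1 (gs j \<circ> fs j) id \<and>
         pointed_homotopic (Ys j) \<mu> (Ys j) \<mu> y1 (fs j \<circ> gs j) id"
      "\<forall>v\<ge>1. \<forall>w\<ge>v. pointed_homotopic (Xs v) \<kappa> (Ys v) \<mu> x1 (fs w) (fs v) \<and>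
         pointed_homotopic (Ys v) \<mu> (Xs v) \<kappa> y1 (gs w) (gs v)"
      unfolding pointed_homotopically_similar_def by metis
    then have "similarity X \<kappa> x1 Y \<mu> y1 Xs Ys fs gs"
      by (intro similarity.intro X.pointed_image_axioms Y.pointed_image_axioms
          similarity_axioms.intro) blast+
    then show thesis by (rule that)
  qed
  then interpret S: similarity X \<kappa> x1 Y \<mu> y1 Xs Ys fs gs .
  have "group_hom X.\<pi> Y.\<pi> S.induced"
    by (intro group_hom.intro group_hom_axioms.intro X.group_fundamental_group
        Y.group_fundamental_group S.induced_hom)
  with S.induced_iso show ?thesis by blast
qed

end
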